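(* Let $\Pi$ be a maximization selection problem with items $[n]$, weights $w$ and feasible collection $\mathcal{X}$. Let $A$ be a $T(n)$-time $\rho$-approximation algorithm for the complementary problem: find $Y\subseteq[n]$ minimizing $w(Y)$ subject to $([n]\setminus Y)\in\mathcal{X}$. Then there exists an $O(T(n))$-time learning-augmented approximation algorithm for $\Pi$ which, receiving a (not necessarily feasible) predicted solution $\widehat{X}\subseteq[n]$, outputs a feasible solution $X\in\mathcal{X}$ such that, for any feasible solution $X'\in\mathcal{X}$, \[ w(X) \geqslant w(X') - (\rho-1)\eta^+ - \eta^-, \] where $(\eta^+,\eta^-)$ is the error of $\widehat{X}$ with respect to $X'$. In particular, if $X'=X^*$ is an optimal solution with value $\mathrm{OPT}$, the algorithm's approximation ratio is at least $1 - \frac{(\rho-1)\eta^+ + \eta^-}{\mathrm{OPT}}$, i.e. $w(X)\geqslant \big(1 - \frac{(\rho-1)\eta^+ + \eta^-}{\mathrm{OPT}}\big)\mathrm{OPT}$.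
   Context: A maximization selection problem: an instance consists of $n$ items $[n]$ with non-negative weights $w:[n]\to\mathbb{R}_{\geqslant0}$ and an implicitly given collection $\mathcal{X}\subseteq 2^{[n]}$ of feasible sets (independent of the weights; any non-negative weights give a valid instance, both for $\Pi$ and for its complementary problem); the task is to find $X\in\mathcal{X}$ maximizing $w(X)=\sum_{i\in X}w(i)$. A $\rho$-approximation algorithm for the (minimization) complementary problem always outputs a feasible $Y$ of weight at most $\rho$ times the minimum. The error of a prediction $\widehat{X}$ with respect to a solution $X$ is $(\eta^+,\eta^-)=(w(\widehat{X}\setminus X), w(X\setminus\widehat{X}))$. *)

theory Defs
  imports Complex_Main "HOL-Library.Landau_Symbols"
begin

text \<open>
  Algorithms are programs of a unit-cost real RAM.  There are two sorts of memory, for natural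
  numbers and for real numbers, each with registers and arrays; only natural numbers serve as
  array indices.  Reals enter a program through its input and by conversion from natural numbers,
  and influence control flow through comparisons only.  The output is a bit string, written
  sequentially on a write-only tape.
\<close>

record state =
  nreg :: "nat \<Rightarrow> nat"
  rreg :: "nat \<Rightarrow> real"
  narr :: "nat \<Rightarrow> nat \<Rightarrow> nat"
  rarr :: "nat \<Rightarrow> nat \<Rightarrow> real"
  tape :: "bool list"

datatype instr =
    NConst nat nat
  | NAdd nat nat nat
  | NSub nat nat nat
  | NMul nat nat nat
  | NDiv nat nat nat
  | NLoad nat nat nat
  | NStore nat nat nat
  | RConv nat nat
  | RAdd nat nat nat
  | RSub nat nat nat
  | RMul nat nat nat
  | RDiv nat nat nat
  | RLoad nat nat nat
  | RStore nat nat nat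
  | Emit bool

datatype test = NLess nat nat | RLess nat nat

datatype com =
    Skip
  | Do instr
  | Seq com com
  | Cond test com com
  | While test com

text \<open>The target comes first; in the array instructions the order is register, array, index for
  loading and array, index, register for storing.\<close>

fun step :: "instr \<Rightarrow> state \<Rightarrow> state" where
  "step (NConst x k) s = s\<lparr>nreg := (nreg s)(x := k)\<rparr>"
| "step (NAdd x y z) s = s\<lparr>nreg := (nreg s)(x := nreg s y + nreg s z)\<rparr>"
| "step (NSub x y z) s = s\<lparr>nreg := (nreg s)(x := nreg s y - nreg s z)\<rparr>"
| "step (NMul x y z) s = s\<lparr>nreg := (nreg s)(x := nreg s y * nreg s z)\<rparr>"
| "step (NDiv x y z) s = s\<lparr>nreg := (nreg s)(x := nreg s y div nreg s z)\<rparr>"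
| "step (NLoad x a y) s = s\<lparr>nreg := (nreg s)(x := narr s a (nreg s y))\<rparr>"
| "step (NStore a y x) s =
     s\<lparr>narr := (narr s)(a := (narr s a)(nreg s y := nreg s x))\<rparr>"
| "step (RConv x y) s = s\<lparr>rreg := (rreg s)(x := real (nreg s y))\<rparr>"
| "step (RAdd x y z) s = s\<lparr>rreg := (rreg s)(x := rreg s y + rreg s z)\<rparr>"
| "step (RSub x y z) s = s\<lparr>rreg := (rreg s)(x := rreg s y - rreg s z)\<rparr>"
| "step (RMul x y z) s = s\<lparr>rreg := (rreg s)(x := rreg s y * rreg s z)\<rparr>"
| "step (RDiv x y z) s = s\<lparr>rreg := (rreg s)(x := rreg s y / rreg s z)\<rparr>"
| "step (RLoad x a y) s = s\<lparr>rreg := (rreg s)(x := rarr s a (nreg s y))\<rparr>"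
| "step (RStore a y x) s =
     s\<lparr>rarr := (rarr s)(a := (rarr s a)(nreg s y := rreg s x))\<rparr>"
| "step (Emit b) s = s\<lparr>tape := tape s @ [b]\<rparr>"

fun holds :: "test \<Rightarrow> state \<Rightarrow> bool" where
  "holds (NLess x y) s \<longleftrightarrow> nreg s x < nreg s y"
| "holds (RLess x y) s \<longleftrightarrow> rreg s x < rreg s y"

text \<open>\<open>exec c s k s'\<close>: started in \<open>s\<close>, the program \<open>c\<close> halts in \<open>s'\<close> after \<open>k\<close> steps; every
  instruction and every evaluation of a test is one step.\<close>

inductive exec :: "com \<Rightarrow> state \<Rightarrow> nat \<Rightarrow> state \<Rightarrow> bool" where
  Skip: "exec Skip s 1 s"
| Do: "exec (Do i) s 1 (step i s)"
| Seq: "exec c1 s k1 s1 \<Longrightarrow> exec c2 s1 k2 s2 \<Longrightarrow> exec (Seq c1 c2) s (k1 + k2) s2"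
| CondTrue: "holds b s \<Longrightarrow> exec c1 s k s' \<Longrightarrow> exec (Cond b c1 c2) s (k + 1) s'"
| CondFalse: "\<not> holds b s \<Longrightarrow> exec c2 s k s' \<Longrightarrow> exec (Cond b c1 c2) s (k + 1) s'"
| WhileFalse: "\<not> holds b s \<Longrightarrow> exec (While b c) s 1 s"
| WhileTrue: "holds b s \<Longrightarrow> exec c s k1 s1 \<Longrightarrow> exec (While b c) s1 k2 s2 \<Longrightarrow>
    exec (While b c) s (k1 + k2 + 1) s2"

lemma exec_deterministic:
  "exec c s k s' \<Longrightarrow> exec c s l t' \<Longrightarrow> l = k \<and> t' = s'"
proof (induction arbitrary: l t' rule: exec.induct)
  case (Skip s)
  from Skip.prems show ?case by cases simp
next
  case (Do i s)
  from Do.prems show ?case by cases simp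
next
  case (Seq c1 s k1 s1 c2 k2 s2)
  from Seq.prems show ?case
  proof cases
    case 1: (Seq l1 t1 l2)
    from Seq.IH(1)[OF 1(2)] Seq.IH(2) 1 show ?thesis by simp
  qed
next
  case (CondTrue b s c1 k s' c2)
  from CondTrue.prems show ?case by cases (simp_all add: CondTrue.hyps CondTrue.IH)
next
  case (CondFalse b s c2 k s' c1)
  from CondFalse.prems show ?case by cases (simp_all add: CondFalse.hyps CondFalse.IH)
next
  case (WhileFalse b s c)
  from WhileFalse.prems show ?case by cases (simp_all add: WhileFalse.hyps)
next
  case (WhileTrue b s c k1 s1 k2 s2)
  from WhileTrue.prems show ?case
  proof cases
    case WhileFalse
    then show ?thesis using WhileTrue.hyps by simp
  next
    case 1: (WhileTrue l1 t1 l2)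
    from WhileTrue.IH(1)[OF 1(3)] WhileTrue.IH(2) 1 show ?thesis by simp
  qed
qed

text \<open>
  Apart from the weights, an instance is an abstract object \<open>I\<close>, which determines the number of
  items and the feasible sets.  It is given to an algorithm only implicitly, through a finite
  amount of discrete and numerical data (for example the edge list of a graph, or the sizes in a
  knapsack instance).
\<close>

record 'i problem =
  instances :: "'i set"
  size_of :: "'i \<Rightarrow> nat"
  feasible :: "'i \<Rightarrow> nat set set"
  ndata :: "'i \<Rightarrow> nat list"
  rdata :: "'i \<Rightarrow> real list"

definition items :: "'i problem \<Rightarrow> 'i \<Rightarrow> nat set" where
  "items P I = {1..size_of P I}"

definition selection_problem :: "'i problem \<Rightarrow> bool" where
  "selection_problem P \<longleftrightarrow> (\<forall>I\<in>instances P. feasible P I \<subseteq> Pow (items P I))"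

definition weighting :: "'i problem \<Rightarrow> 'i \<Rightarrow> (nat \<Rightarrow> real) \<Rightarrow> bool" where
  "weighting P I w \<longleftrightarrow> (\<forall>i\<in>items P I. 0 \<le> w i)"

definition complementary :: "'i problem \<Rightarrow> 'i problem" where
  "complementary P =
     P\<lparr>feasible := \<lambda>I. {Y. Y \<subseteq> items P I \<and> items P I - Y \<in> feasible P I}\<rparr>"

definition prediction_error :: "(nat \<Rightarrow> real) \<Rightarrow> nat set \<Rightarrow> nat set \<Rightarrow> real \<times> real" where
  "prediction_error w Xhat X = (sum w (Xhat - X), sum w (X - Xhat))"

definition cells :: "'a::zero list \<Rightarrow> nat \<Rightarrow> 'a" where
  "cells xs j = (if j < length xs then xs ! j else 0)"

text \<open>The weight of item \<open>i\<close> is in cell \<open>i\<close> of real array 0, and its membership in the prediction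
  in cell \<open>i\<close> of natural-number array 1.  Memory not holding input is zero.\<close>

definition input :: "'i problem \<Rightarrow> 'i \<Rightarrow> (nat \<Rightarrow> real) \<Rightarrow> state" where
  "input P I w =
     \<lparr>nreg = (\<lambda>_. 0)(0 := size_of P I, 1 := length (ndata P I), 2 := length (rdata P I)),
      rreg = (\<lambda>_. 0),
      narr = (\<lambda>_ _. 0)(0 := cells (ndata P I)),
      rarr = (\<lambda>_ _. 0)(0 := (\<lambda>i. if i \<in> items P I then w i else 0), 1 := cells (rdata P I)),
      tape = []\<rparr>"

definition input_with_prediction ::
    "'i problem \<Rightarrow> 'i \<Rightarrow> (nat \<Rightarrow> real) \<Rightarrow> nat set \<Rightarrow> state" where
  "input_with_prediction P I w Xhat =
     (input P I w)\<lparr>narr := (narr (input P I w))(1 := (\<lambda>i. if i \<in> Xhat then 1 else 0))\<rparr>"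

text \<open>A set of items is output as its characteristic vector of length \<open>n\<close>, item 1
  first; in particular every algorithm takes at least \<open>n\<close> steps.\<close>

definition outputs :: "com \<Rightarrow> state \<Rightarrow> nat \<Rightarrow> nat set \<Rightarrow> nat \<Rightarrow> bool" where
  "outputs c s n X k \<longleftrightarrow>
     (\<exists>s'. exec c s k s' \<and> length (tape s') = n \<and> X = {i \<in> {1..n}. tape s' ! (i - 1)})"

definition min_approx_algorithm ::
    "'i problem \<Rightarrow> (nat \<Rightarrow> real) \<Rightarrow> real \<Rightarrow> com \<Rightarrow> bool" where
  "min_approx_algorithm P T \<rho> A \<longleftrightarrow>
     (\<forall>I\<in>instances P. \<forall>w. weighting P I w \<longrightarrow>
       (\<exists>Y k. outputs A (input P I w) (size_of P I) Y k \<and> real k \<le> T (size_of P I) \<and>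
          Y \<in> feasible P I \<and> sum w Y \<le> \<rho> * Min (sum w ` feasible P I)))"

end

theory Submission
  imports Defs
begin

text \<open>
  Set the weights of all items outside the prediction to zero, run \<open>A\<close> for the complementary
  problem on these weights \<open>w'\<close>, and return the complement \<open>X\<close> of its answer \<open>Y\<close>.  For feasible
  \<open>X'\<close> the complement of \<open>X'\<close> has \<open>w'\<close>-weight \<open>w(Xhat - X') = \<eta>p\<close>, so
  \<open>w(Xhat - X) = w'(Y) \<le> \<rho> * \<eta>p\<close> and hence
  \<open>w(X) \<ge> w(Xhat) - \<rho> * \<eta>p = w(X') - \<eta>m + \<eta>p - \<rho> * \<eta>p\<close>.

  On the machine, a linear-time loop overwrites the weights and restores all other memory to what
  \<open>A\<close> expects as input.  The output tape cannot be read by a program, so complementing the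
  output amounts to negating every emitted bit.
\<close>

section \<open>Complementing the output of a program\<close>

fun negate_instr :: "instr \<Rightarrow> instr" where
  "negate_instr (Emit b) = Emit (\<not> b)"
| "negate_instr i = i"

fun negate_output :: "com \<Rightarrow> com" where
  "negate_output Skip = Skip"
| "negate_output (Do i) = Do (negate_instr i)"
| "negate_output (Seq c d) = Seq (negate_output c) (negate_output d)"
| "negate_output (Cond b c d) = Cond b (negate_output c) (negate_output d)"
| "negate_output (While b c) = While b (negate_output c)"

definition negate_tape :: "state \<Rightarrow> state" where
  "negate_tape s = s\<lparr>tape := map Not (tape s)\<rparr>"

lemma step_negate_instr: "step (negate_instr i) (negate_tape s) = negate_tape (step i s)"
  by (cases i) (simp_all add: negate_tape_def)

lemma holds_negate_tape [simp]: "holds b (negate_tape s) = holds b s"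
  by (cases b) (simp_all add: negate_tape_def)

text \<open>No instruction or test reads the tape, so both runs take the same branches and the same
  number of steps; only the emitted bits differ.\<close>

lemma exec_negate_output:
  "exec c s k s' \<Longrightarrow> exec (negate_output c) (negate_tape s) k (negate_tape s')"
proof (induction rule: exec.induct)
  case (Do i s)
  show ?case
    using exec.Do[of "negate_instr i" "negate_tape s"] by (simp add: step_negate_instr)
qed (auto intro: exec.intros simp del: One_nat_def)

lemma outputs_negate_output:
  assumes "outputs c s n Y k" and "tape s = []"
  shows "outputs (negate_output c) s n ({1..n} - Y) k"
proof -
  obtain s' where s': "exec c s k s'" "length (tape s') = n" "Y = {i \<in> {1..n}. tape s' ! (i - 1)}"
    using assms(1) by (auto simp: outputs_def)
  have "negate_tape s = s"
    using assms(2) by (simp add: negate_tape_def)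
  with exec_negate_output[OF s'(1)] have "exec (negate_output c) s k (negate_tape s')"
    by simp
  moreover have "length (tape (negate_tape s')) = n"
    "{1..n} - Y = {i \<in> {1..n}. tape (negate_tape s') ! (i - 1)}"
    using s'(2,3) by (auto simp: negate_tape_def)
  ultimately show ?thesis
    unfolding outputs_def by blast
qed

lemma outputs_Seq:
  assumes "exec c s k t" and "outputs d t n X l"
  shows "outputs (Seq c d) s n X (k + l)"
  using assms exec.Seq unfolding outputs_def by blast

section \<open>Lower bounds on the running time\<close>

lemma exec_time_pos: "exec c s k s' \<Longrightarrow> 0 < k"
  by (induction rule: exec.induct) auto

lemma length_tape_step: "length (tape (step i s)) \<le> length (tape s) + 1"
  by (cases i) simp_all

text \<open>A step emits at most one bit, so writing \<open>n\<close> bits on an empty tape takes at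
  least \<open>n\<close> steps. This lets the running time of \<open>A\<close> absorb the linear
  cost of masking.\<close>

lemma length_tape_exec: "exec c s k s' \<Longrightarrow> length (tape s') \<le> length (tape s) + k"
  by (induction rule: exec.induct) (use length_tape_step in auto)

section \<open>Restricting the weights to the prediction\<close>

text \<open>Natural register 3 is the item counter, 4 holds the constant 1, and 5 is scratch. Real
  register 0 is never written, so storing it writes a zero weight.\<close>

definition mask_body :: com where
  "mask_body =
     Seq (Do (NAdd 3 3 4))
    (Seq (Do (NLoad 5 1 3))
    (Seq (Cond (NLess 5 4) (Do (RStore 0 3 0)) Skip)
    (Seq (Do (NConst 5 0))
         (Do (NStore 1 3 5)))))"

definition mask_weights :: com where
  "mask_weights =
     Seq (Do (NConst 4 1))
    (Seq (While (NLess 3 0) mask_body)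
    (Seq (Do (NConst 3 0))
         (Do (NConst 4 0))))"

text \<open>The loop invariant after \<open>j\<close> rounds. It fixes the entire state, because the
  guarantee for \<open>A\<close> covers only runs started exactly in an \<open>input\<close> state;
  hence prediction bits are erased along the way.\<close>

definition masked_upto :: "'i problem \<Rightarrow> 'i \<Rightarrow> (nat \<Rightarrow> real) \<Rightarrow> nat set \<Rightarrow> nat \<Rightarrow> state" where
  "masked_upto P I w Xhat j =
     (input P I (\<lambda>i. if i \<le> j \<longrightarrow> i \<in> Xhat then w i else 0))
       \<lparr>nreg := (nreg (input P I w))(3 := j, 4 := 1),
        narr := (narr (input P I w))(1 := (\<lambda>i. if i \<in> Xhat \<and> j < i then 1 else 0))\<rparr>"

text \<open>Both branches of the conditional cost one step after the test, so the count of 6 does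
  not depend on \<open>Xhat\<close>.\<close>

lemma exec_mask_body:
  assumes "j < size_of P I"
  shows "exec mask_body (masked_upto P I w Xhat j) 6 (masked_upto P I w Xhat (Suc j))"
proof -
  define s1 where "s1 = step (NLoad 5 1 3) (step (NAdd 3 3 4) (masked_upto P I w Xhat j))"
  define s2 where "s2 = (if Suc j \<in> Xhat then s1 else step (RStore 0 3 0) s1)"
  have "holds (NLess 5 4) s1 \<longleftrightarrow> Suc j \<notin> Xhat"
    by (simp add: s1_def masked_upto_def)
  then have "exec (Cond (NLess 5 4) (Do (RStore 0 3 0)) Skip) s1 (1 + 1) s2"
    using exec.CondTrue[OF _ exec.Do] exec.CondFalse[OF _ exec.Skip] unfolding s2_def by metis
  then have "exec mask_body (masked_upto P I w Xhat j) (1 + (1 + ((1 + 1) + (1 + 1))))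
      (step (NStore 1 3 5) (step (NConst 5 0) s2))"
    unfolding mask_body_def s1_def
    by (rule exec.Seq[OF exec.Do exec.Seq[OF exec.Do exec.Seq[OF _ exec.Seq[OF exec.Do exec.Do]]]])
  moreover have "step (NStore 1 3 5) (step (NConst 5 0) s2) = masked_upto P I w Xhat (Suc j)"
    using assms
    by (auto simp: s2_def s1_def masked_upto_def input_def items_def fun_eq_iff le_Suc_eq)
  ultimately show ?thesis
    by (simp add: numeral_eq_Suc)
qed

text \<open>A round costs 6 steps plus one test, and the final failing test adds 1. Unrolling the
  first round makes the induction run downward from \<open>size_of P I\<close>.\<close>

lemma exec_mask_loop:
  assumes "j \<le> size_of P I"
  shows "exec (While (NLess 3 0) mask_body) (masked_upto P I w Xhat j)
    (7 * (size_of P I - j) + 1) (masked_upto P I w Xhat (size_of P I))"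
  using assms
proof (induction j rule: inc_induct)
  case base
  have "\<not> holds (NLess 3 0) (masked_upto P I w Xhat (size_of P I))"
    by (simp add: masked_upto_def input_def)
  then show ?case
    using exec.WhileFalse by simp
next
  case (step j)
  have "holds (NLess 3 0) (masked_upto P I w Xhat j)"
    using step.hyps by (simp add: masked_upto_def input_def)
  from exec.WhileTrue[OF this exec_mask_body[OF step.hyps(2)] step.IH]
  have "exec (While (NLess 3 0) mask_body) (masked_upto P I w Xhat j)
      (6 + (7 * (size_of P I - Suc j) + 1) + 1) (masked_upto P I w Xhat (size_of P I))" .
  moreover have "6 + (7 * (size_of P I - Suc j) + 1) + 1 = 7 * (size_of P I - j) + 1"
    using step.hyps by simp
  ultimately show ?case
    by (simp only:)
qed

lemma exec_mask_weights:
  assumes "Xhat \<subseteq> items P I"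
  shows "exec mask_weights (input_with_prediction P I w Xhat) (7 * size_of P I + 4)
    (input P I (\<lambda>i. if i \<in> Xhat then w i else 0))"
proof -
  let ?n = "size_of P I"
  have start: "step (NConst 4 1) (input_with_prediction P I w Xhat) = masked_upto P I w Xhat 0"
    using assms
    \<comment> \<open>The loop visits only cells 1 to \<open>?n\<close>;
      \<open>Xhat \<subseteq> items P I\<close> ensures that no prediction bit lies elsewhere, here
      in cell 0.\<close>
    by (auto simp: input_with_prediction_def input_def masked_upto_def items_def fun_eq_iff)
  have finish: "step (NConst 4 0) (step (NConst 3 0) (masked_upto P I w Xhat ?n)) =
      input P I (\<lambda>i. if i \<in> Xhat then w i else 0)"
    using assms by (auto simp: input_def masked_upto_def items_def fun_eq_iff)
  have "exec mask_weights (input_with_prediction P I w Xhat) (1 + ((7 * (?n - 0) + 1) + (1 + 1)))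
      (step (NConst 4 0) (step (NConst 3 0) (masked_upto P I w Xhat ?n)))"
    unfolding mask_weights_def
    by (rule exec.Seq[OF exec.Do exec.Seq[OF _ exec.Seq[OF exec.Do exec.Do]]])
      (unfold start, rule exec_mask_loop, simp)
  then show ?thesis
    unfolding finish by (simp add: eval_nat_numeral)
qed

section \<open>The approximation guarantee\<close>

text \<open>Split \<open>Xhat\<close> along \<open>Y\<close> and along \<open>X'\<close>, and
  \<open>X'\<close> along \<open>Xhat\<close>. Nonnegativity allows discarding the part of
  \<open>U - Y\<close> outside \<open>Xhat\<close>.\<close>

lemma complement_weight_bound:
  fixes w :: "'a \<Rightarrow> real"
  assumes "finite U" and "\<And>i. i \<in> U \<Longrightarrow> 0 \<le> w i"
    and "Xhat \<subseteq> U" "X' \<subseteq> U" "Y \<subseteq> U"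
    and "sum w (Xhat \<inter> Y) \<le> \<rho> * sum w (Xhat - X')"
  shows "sum w X' - (\<rho> - 1) * sum w (Xhat - X') - sum w (X' - Xhat) \<le> sum w (U - Y)"
proof -
  have fin: "finite Xhat" "finite X'"
    using assms(1,3,4) finite_subset by auto
  have "sum w Xhat = sum w (Xhat \<inter> Y) + sum w (Xhat - Y)"
    and "sum w Xhat = sum w (Xhat \<inter> X') + sum w (Xhat - X')"
    and "sum w X' = sum w (Xhat \<inter> X') + sum w (X' - Xhat)"
    using fin sum.Int_Diff[of Xhat w Y] sum.Int_Diff[of Xhat w X'] sum.Int_Diff[of X' w Xhat]
    by (simp_all add: Int_commute)
  moreover have "sum w (Xhat - Y) \<le> sum w (U - Y)"
    using assms(1-3) by (intro sum_mono2) auto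
  ultimately show ?thesis
    using assms(6) by (simp add: algebra_simps)
qed

theorem theorem2:
  fixes P :: "'i problem" and T :: "nat \<Rightarrow> real" and \<rho> :: real and A :: com
  assumes "selection_problem P"
    and "1 \<le> \<rho>"
    and "min_approx_algorithm (complementary P) T \<rho> A"
  shows "\<exists>B T'. T' \<in> O(T) \<and>
    (\<forall>I\<in>instances P. \<forall>w. weighting P I w \<longrightarrow> (\<forall>Xhat. Xhat \<subseteq> items P I \<longrightarrow>
      (\<exists>X k. outputs B (input_with_prediction P I w Xhat) (size_of P I) X k \<and>
         real k \<le> T' (size_of P I) \<and>
         X \<in> feasible P I \<and>
         (\<forall>X'\<in>feasible P I. \<forall>\<eta>p \<eta>m. prediction_error w Xhat X' = (\<eta>p, \<eta>m) \<longrightarrow>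
            sum w X \<ge> sum w X' - (\<rho> - 1) * \<eta>p - \<eta>m) \<and>
         (\<forall>Xstar OPT \<eta>p \<eta>m. is_arg_max (sum w) (\<lambda>Z. Z \<in> feasible P I) Xstar \<longrightarrow>
            OPT = sum w Xstar \<longrightarrow> prediction_error w Xhat Xstar = (\<eta>p, \<eta>m) \<longrightarrow>
            sum w X \<ge> (1 - ((\<rho> - 1) * \<eta>p + \<eta>m) / OPT) * OPT))))"
proof (intro exI[of _ "Seq mask_weights (negate_output A)"] exI[of _ "\<lambda>n. 12 * T n"]
    conjI ballI allI impI)
  show "(\<lambda>n. 12 * T n) \<in> O(T)"
    by simp
next
  fix I w Xhat
  assume I: "I \<in> instances P" and w: "weighting P I w" and Xhat: "Xhat \<subseteq> items P I"
  let ?n = "size_of P I" and ?U = "items P I" and ?Q = "complementary P"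
  let ?w = "\<lambda>i. if i \<in> Xhat then w i else 0"
  have fin: "finite ?U"
    by (simp add: items_def)
  have nonneg: "0 \<le> w i" if "i \<in> ?U" for i
    using w that by (simp add: weighting_def)
  \<comment> \<open>Complementing alters only the feasible sets, so the state left by
    \<open>mask_weights\<close> is a legitimate input for \<open>A\<close>.\<close>
  have Q: "instances ?Q = instances P" "size_of ?Q = size_of P" "items ?Q = items P"
    "input ?Q = input P"
    by (simp_all add: complementary_def items_def input_def fun_eq_iff)
  have feasible_Q: "feasible ?Q I = {Y. Y \<subseteq> ?U \<and> ?U - Y \<in> feasible P I}"
    by (simp add: complementary_def)
  have "weighting ?Q I ?w"
    using w by (simp add: weighting_def Q)
  then obtain Y k where out: "outputs A (input P I ?w) ?n Y k" and k: "real k \<le> T ?n"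
    and Y: "Y \<in> feasible ?Q I" "sum ?w Y \<le> \<rho> * Min (sum ?w ` feasible ?Q I)"
    using assms(3) I unfolding min_approx_algorithm_def unfolding Q by blast
  have Y_sub: "Y \<subseteq> ?U" and feas: "?U - Y \<in> feasible P I"
    using Y(1) by (auto simp: feasible_Q)
  have "tape (input P I ?w) = []"
    by (simp add: input_def)
  from outputs_negate_output[OF out this]
  have "outputs (negate_output A) (input P I ?w) ?n (?U - Y) k"
    by (simp add: items_def)
  from outputs_Seq[OF exec_mask_weights[OF Xhat] this]
  have out': "outputs (Seq mask_weights (negate_output A)) (input_with_prediction P I w Xhat) ?n
      (?U - Y) (7 * ?n + 4 + k)" .
  obtain s' where s': "exec A (input P I ?w) k s'" "length (tape s') = ?n"
    using out by (auto simp: outputs_def)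
  have "?n \<le> k"
    using length_tape_exec[OF s'(1)] s'(2) by (simp add: input_def)
  moreover have "0 < k"
    using exec_time_pos[OF s'(1)] .
  \<comment> \<open>As \<open>?n\<close> and 1 are at most \<open>k\<close>, the constant is 12 = 7
    + 4 + 1.\<close>
  ultimately have "7 * ?n + 4 + k \<le> 12 * k"
    by simp
  then have "real (7 * ?n + 4 + k) \<le> 12 * real k"
    by linarith
  then have time: "real (7 * ?n + 4 + k) \<le> 12 * T ?n"
    using k by linarith
  have bound: "sum w X' - (\<rho> - 1) * sum w (Xhat - X') - sum w (X' - Xhat) \<le> sum w (?U - Y)"
    if X': "X' \<in> feasible P I" for X'
  proof -
    have X'_sub: "X' \<subseteq> ?U"
      using assms(1) I X' by (auto simp: selection_problem_def)
    then have "?U - X' \<in> feasible ?Q I"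
      using X' by (simp add: feasible_Q double_diff)
    \<comment> \<open>\<open>Min\<close> is a lower bound only on finite sets.\<close>
    moreover have "finite (feasible ?Q I)"
      using fin by (rule finite_subset[rotated, OF finite_Pow_iff[THEN iffD2]])
        (auto simp: feasible_Q)
    ultimately have "Min (sum ?w ` feasible ?Q I) \<le> sum ?w (?U - X')"
      by (intro Min_le) auto
    then have "\<rho> * Min (sum ?w ` feasible ?Q I) \<le> \<rho> * sum ?w (?U - X')"
      using assms(2) by (intro mult_left_mono) auto
    with Y(2) have "sum ?w Y \<le> \<rho> * sum ?w (?U - X')"
      by linarith
    moreover have "sum ?w Z = sum w (Xhat \<inter> Z)" if "Z \<subseteq> ?U" for Z
      using that fin finite_subset[OF that fin]
      by (simp add: sum.inter_restrict[symmetric] Int_commute)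
    moreover have "Xhat \<inter> (?U - X') = Xhat - X'"
      using Xhat by blast
    ultimately have "sum w (Xhat \<inter> Y) \<le> \<rho> * sum w (Xhat - X')"
      using Y_sub by simp
    with fin nonneg Xhat X'_sub Y_sub show ?thesis
      by (rule complement_weight_bound)
  qed
  have ratio: "(1 - ((\<rho> - 1) * \<eta>p + \<eta>m) / OPT) * OPT \<le> sum w (?U - Y)"
    if "is_arg_max (sum w) (\<lambda>Z. Z \<in> feasible P I) Xstar" "OPT = sum w Xstar"
      "prediction_error w Xhat Xstar = (\<eta>p, \<eta>m)" for Xstar OPT \<eta>p \<eta>m
  proof (cases "OPT = 0")
    \<comment> \<open>The factor \<open>OPT\<close> makes the left side zero, whatever the quotient
      is.\<close>
    case True
    then show ?thesis
      using nonneg by (auto intro: sum_nonneg)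
  next
    case False
    then have "(1 - ((\<rho> - 1) * \<eta>p + \<eta>m) / OPT) * OPT = OPT - (\<rho> - 1) * \<eta>p - \<eta>m"
      by (simp add: field_simps)
    then show ?thesis
      using bound[of Xstar] that by (simp add: is_arg_max_def prediction_error_def)
  qed
  show "\<exists>X k. outputs (Seq mask_weights (negate_output A)) (input_with_prediction P I w Xhat) ?n X k \<and>
         real k \<le> 12 * T ?n \<and>
         X \<in> feasible P I \<and>
         (\<forall>X'\<in>feasible P I. \<forall>\<eta>p \<eta>m. prediction_error w Xhat X' = (\<eta>p, \<eta>m) \<longrightarrow>
            sum w X \<ge> sum w X' - (\<rho> - 1) * \<eta>p - \<eta>m) \<and>
         (\<forall>Xstar OPT \<eta>p \<eta>m. is_arg_max (sum w) (\<lambda>Z. Z \<in> feasible P I) Xstar \<longrightarrow>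
            OPT = sum w Xstar \<longrightarrow> prediction_error w Xhat Xstar = (\<eta>p, \<eta>m) \<longrightarrow>
            sum w X \<ge> (1 - ((\<rho> - 1) * \<eta>p + \<eta>m) / OPT) * OPT)"
    by (rule exI[of _ "?U - Y"], rule exI[of _ "7 * ?n + 4 + k"])
      (use out' time feas bound ratio in \<open>auto simp: prediction_error_def\<close>)
qed

end
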